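(* Among all groups of a given finite order, the cyclic group of that order has the maximum number of undirected edges in its directed power graph. That is, for every positive integer $n$ and every group $G$ of order $n$, $|\overleftrightarrow{E}(G)|\le |\overleftrightarrow{E}(C_n)|$, where $C_n$ is the cyclic group of order $n$.
   Context: The directed power graph of a group $G$ has vertex set $G$ and directed edge set $\overrightarrow{E}(G)=\{(g,h) \mid g,h\in G,\ h\in\langle g\rangle\setminus\{g\}\}$. The set of undirected edges of the directed power graph of $G$ is $\overleftrightarrow{E}(G)=\{\{g,h\}\mid (g,h)\in\overrightarrow{E}(G) \text{ and } (h,g)\in \overrightarrow{E}(G)\}$. *)

theory Defs
  imports "HOL-Algebra.Algebra" "Graph_Theory.Pair_Digraph"
begin

definition directed_power_graph :: "('a, 'm) monoid_scheme \<Rightarrow> 'a pair_pre_digraph" where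
  "directed_power_graph G =
     \<lparr> pverts = carrier G,
       parcs = {(g, h). g \<in> carrier G \<and> h \<in> carrier G \<and> h \<in> generate G {g} - {g}} \<rparr>"

text \<open>A pair of opposite arcs contributes a single, unordered edge.\<close>

definition undirected_edges :: "'a pair_pre_digraph \<Rightarrow> 'a set set" where
  "undirected_edges D = {{g, h} | g h. (g, h) \<in> parcs D \<and> (h, g) \<in> parcs D}"

end

theory Submission
  imports Defs "HOL-Number_Theory.Totient"
begin

text \<open>
  Counting pairs of mutually generating elements gives \<open>2 |E| + n = \<Sum>g\<in>G. \<phi>(ord g)\<close>, so the claim is
  that this sum is at most \<open>\<Psi>(n) = \<Sum>d|n. \<phi>(d)\<^sup>2\<close>, its value for the cyclic group. This goes by
  induction on \<open>n\<close>. If no \<open>x \<in> G\<close> satisfies \<open>n \<phi>(ord x) > \<Psi>(n)\<close>, sum over \<open>G\<close>. Otherwise a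
  prime-by-prime estimate of \<open>\<Psi>(n) / (n \<phi>(ord x))\<close> shows that \<open>\<langle>x\<rangle>\<close> has index less than the largest
  prime divisor \<open>p\<close> of \<open>n\<close>. Then the Sylow \<open>p\<close>-subgroup \<open>P\<close> of \<open>\<langle>x\<rangle>\<close> is a cyclic normal Sylow subgroup
  of \<open>G\<close>, and choosing in each coset of \<open>P\<close> a representative whose order is that of the coset gives
  \<open>(\<Sum>g\<in>G. \<phi>(ord g)) \<le> \<Psi>(|P|) (\<Sum>C\<in>G/P. \<phi>(ord C))\<close>, to which the induction hypothesis applies.
\<close>

hide_const (open) Divisibility.prime

section \<open>Sums of squared totients over divisors\<close>

definition totient_sq_sum :: "nat \<Rightarrow> nat" where
  "totient_sq_sum n = (\<Sum>d | d dvd n. totient d ^ 2)"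

lemma totient_sq_sum_1 [simp]: "totient_sq_sum (Suc 0) = 1"
  by (simp add: totient_sq_sum_def)

text \<open>Multiplication maps pairs of divisors of \<open>a\<close> and \<open>b\<close>
  bijectively onto the divisors of \<open>a * b\<close>, and \<open>totient\<close> splits on each
  such product.\<close>

lemma totient_sq_sum_mult_coprime:
  assumes "coprime a b" "a > 0" "b > 0"
  shows "totient_sq_sum (a * b) = totient_sq_sum a * totient_sq_sum b"
proof -
  let ?D = "\<lambda>n::nat. {d. d dvd n}" and ?f = "\<lambda>(x, y). x * y :: nat"
  have inj: "inj_on ?f (?D a \<times> ?D b)"
  proof (rule inj_onI, clarify)
    fix x y x' y' assume d: "x dvd a" "y dvd b" "x' dvd a" "y' dvd b" and eq: "x * y = x' * y'"
    have "coprime x y'" "coprime x' y"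
      using d assms(1) by (meson coprime_divisors)+
    with eq have "x dvd x'" "x' dvd x"
      by (metis coprime_dvd_mult_left_iff dvd_triv_left)+
    then have "x = x'" by (rule dvd_antisym)
    moreover have "x > 0" using d(1) assms(2) by (rule dvd_pos_nat[rotated])
    ultimately show "x = x' \<and> y = y'" using eq by simp
  qed
  have img: "?f ` (?D a \<times> ?D b) = ?D (a * b)"
  proof (intro equalityI subsetI)
    fix d assume "d \<in> ?D (a * b)"
    then obtain x y where "d = x * y" "x dvd a" "y dvd b" by (auto elim: dvd_productE)
    then show "d \<in> ?f ` (?D a \<times> ?D b)" by (intro image_eqI[of _ _ "(x, y)"]) auto
  qed (auto intro: mult_dvd_mono)
  have "totient_sq_sum (a * b) = (\<Sum>(x, y) \<in> ?D a \<times> ?D b. totient (x * y) ^ 2)"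
    unfolding totient_sq_sum_def img[symmetric] by (subst sum.reindex[OF inj]) (simp add: case_prod_unfold)
  also have "\<dots> = (\<Sum>(x, y) \<in> ?D a \<times> ?D b. totient x ^ 2 * totient y ^ 2)"
    using assms(1) by (intro sum.cong refl) (auto simp: totient_mult_coprime power_mult_distrib coprime_divisors[OF _ _ assms(1)])
  finally show ?thesis
    by (simp add: totient_sq_sum_def sum_product sum.cartesian_product)
qed

text \<open>For \<open>i > 0\<close> the summands are \<open>p^(2i-2) (p-1)^2\<close>, a geometric
  progression of ratio \<open>p^2\<close>. The factor \<open>p + 1\<close> clears the denominator
  that remains of \<open>p^2 - 1\<close>.\<close>

lemma totient_sq_sum_prime_power:
  assumes "prime p"
  shows "(real p + 1) * real (totient_sq_sum (p ^ a)) = real p ^ (2 * a) * (real p - 1) + 2"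
proof -
  have p: "p > 1" using assms by (rule prime_gt_1_nat)
  have "{d. d dvd p ^ a} = (\<lambda>i. p ^ i) ` {..a}"
    using assms by (auto simp: divides_primepow_nat le_imp_power_dvd)
  then have *: "totient_sq_sum (p ^ a) = (\<Sum>i\<le>a. totient (p ^ i) ^ 2)"
    using p unfolding totient_sq_sum_def
    by (simp add: sum.reindex inj_on_def)
  show ?thesis unfolding *
  proof (induction a)
    case (Suc a)
    have "real (totient (p ^ Suc a)) = real p ^ a * (real p - 1)"
      using assms p by (simp add: totient_prime_power_Suc del: power_Suc)
    then have "real (\<Sum>i\<le>Suc a. totient (p ^ i) ^ 2)
        = real (\<Sum>i\<le>a. totient (p ^ i) ^ 2) + (real p ^ a * (real p - 1)) ^ 2"
      by (simp del: power_Suc)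
    then have "(real p + 1) * real (\<Sum>i\<le>Suc a. totient (p ^ i) ^ 2)
        = real p ^ (2 * a) * (real p - 1) + 2 + (real p + 1) * (real p ^ a * (real p - 1)) ^ 2"
      using Suc by (simp only: distrib_left)
    also have "\<dots> = real p ^ (2 * Suc a) * (real p - 1) + 2"
      by (simp add: algebra_simps power2_eq_square power_mult)
    finally show ?case .
  qed simp
qed

lemma totient_sq_sum_ge: "totient_sq_sum n \<ge> n"
proof -
  have "totient d \<le> totient d ^ 2" for d by (cases "totient d") (simp_all add: power2_eq_square)
  then have "(\<Sum>d | d dvd n. totient d) \<le> totient_sq_sum n"
    unfolding totient_sq_sum_def by (intro sum_mono)
  then show ?thesis by (simp add: totient_divisor_sum)
qed

section \<open>Factorisation of the ratio into local factors\<close>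

text \<open>Serves both \<open>totient_sq_sum\<close> and \<open>totient\<close>. Exponents may be
  zero, so \<open>A\<close> may contain primes that divide nothing in question.\<close>

lemma prod_prime_powers:
  fixes e :: "nat \<Rightarrow> nat" and f :: "nat \<Rightarrow> nat"
  assumes mult: "\<And>a b. coprime a b \<Longrightarrow> a > 0 \<Longrightarrow> b > 0 \<Longrightarrow> f (a * b) = f a * f b" and "f 1 = 1"
    and "finite A" "\<And>p. p \<in> A \<Longrightarrow> prime p"
  shows "f (\<Prod>p\<in>A. p ^ e p) = (\<Prod>p\<in>A. f (p ^ e p))"
  using assms(3,4)
proof (induction A)
  case (insert p A)
  have "coprime (p ^ e p) (\<Prod>q\<in>A. q ^ e q)"
  proof (rule prod_coprime_right)
    fix q assume "q \<in> A"
    then have "prime p" "prime q" "p \<noteq> q" using insert by auto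
    then have "coprime p q" by (rule primes_coprime)
    then show "coprime (p ^ e p) (q ^ e q)" by simp
  qed
  moreover have "(\<Prod>q\<in>A. q ^ e q) > 0" "p ^ e p > 0"
    using insert.prems by (auto intro!: prod_pos simp: prime_gt_0_nat)
  ultimately show ?case using insert mult by simp
qed (use assms in simp)

text \<open>The factor at \<open>q\<close> of \<open>\<Psi>(n) / (n \<phi>(d))\<close>, where \<open>a\<close> and \<open>b\<close> are the multiplicities of \<open>q\<close> in
  \<open>n\<close> and \<open>d\<close>; it is \<open>1\<close> if \<open>a = b = 0\<close>, so products may range over all primes up to a bound.\<close>
definition local_ratio :: "nat \<Rightarrow> nat \<Rightarrow> nat \<Rightarrow> real" where
  "local_ratio q a b = real (totient_sq_sum (q ^ a)) / (real (q ^ a) * real (totient (q ^ b)))"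

lemma local_ratio_nonneg: "local_ratio q a b \<ge> 0"
  by (simp add: local_ratio_def)

lemma prime_power_decomposition:
  fixes n :: nat
  assumes "n > 0" "finite A" "\<And>q. q \<in> A \<Longrightarrow> prime q" "prime_factors n \<subseteq> A"
  shows "n = (\<Prod>q\<in>A. q ^ multiplicity q n)"
proof -
  have "(\<Prod>q\<in>A. q ^ multiplicity q n) = (\<Prod>q\<in>prime_factors n. q ^ multiplicity q n)"
    using assms by (intro prod.mono_neutral_right) (auto simp: prime_factors_multiplicity)
  then show ?thesis using prime_factorization_nat[OF assms(1)] by simp
qed

lemma ratio_eq_prod_local_ratio:
  assumes "n > 0" "d dvd n" "finite A" "\<And>q. q \<in> A \<Longrightarrow> prime q" "prime_factors n \<subseteq> A"
  shows "real (totient_sq_sum n) / (real n * real (totient d))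
       = (\<Prod>q\<in>A. local_ratio q (multiplicity q n) (multiplicity q d))"
proof -
  have "d > 0" using assms by (metis dvd_pos_nat)
  have sub: "prime_factors d \<subseteq> A" using assms dvd_prime_factors[of n d] by auto
  have n: "n = (\<Prod>q\<in>A. q ^ multiplicity q n)"
    by (rule prime_power_decomposition) (use assms in auto)
  have d: "d = (\<Prod>q\<in>A. q ^ multiplicity q d)"
    by (rule prime_power_decomposition) (use assms(3,4) sub \<open>d > 0\<close> in auto)
  have "totient_sq_sum (\<Prod>q\<in>A. q ^ multiplicity q n) = (\<Prod>q\<in>A. totient_sq_sum (q ^ multiplicity q n))"
    by (rule prod_prime_powers) (use assms(3,4) totient_sq_sum_mult_coprime in auto)
  moreover have "totient (\<Prod>q\<in>A. q ^ multiplicity q d) = (\<Prod>q\<in>A. totient (q ^ multiplicity q d))"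
    by (rule prod_prime_powers) (use assms(3,4) totient_mult_coprime in auto)
  moreover have "real n = (\<Prod>q\<in>A. real (q ^ multiplicity q n))"
    unfolding of_nat_prod[symmetric] by (rule arg_cong[OF n])
  ultimately show ?thesis
    unfolding local_ratio_def prod_dividef prod.distrib n[symmetric] d[symmetric]
    by (simp del: of_nat_power flip: of_nat_prod)
qed


section \<open>Lower bounds for the local factors\<close>

lemma local_ratio_coprime:
  assumes "prime q"
  shows "local_ratio q a 0 = (real q ^ (2 * a) * (real q - 1) + 2) / ((real q + 1) * real q ^ a)"
  unfolding local_ratio_def totient_sq_sum_prime_power[OF assms, of a, symmetric] by simp

lemma local_ratio_Suc:
  assumes "prime q"
  shows "local_ratio q a (Suc b) = (real q ^ (2 * a) * (real q - 1) + 2)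
           / ((real q + 1) * real q ^ a * real q ^ b * (real q - 1))"
proof -
  have q: "real q > 1" using prime_gt_1_nat[OF assms] by simp
  have t: "real (totient (q ^ Suc b)) = real q ^ b * (real q - 1)"
    using assms q by (simp add: totient_prime_power_Suc del: power_Suc)
  show ?thesis
    unfolding local_ratio_def t totient_sq_sum_prime_power[OF assms, of a, symmetric] using q
    by (simp add: mult.assoc)
qed

text \<open>For \<open>b > 0\<close> the bound is the exact formula with the summand 2 of the
  numerator dropped. The power \<open>q^(a-b)\<close> is the contribution of \<open>q\<close> to the
  index.\<close>

lemma local_ratio_ge_if_dvd:
  assumes q: "prime q" and "b \<le> a" "b > 0 \<or> a = 0"
  shows "local_ratio q a b \<ge> real q ^ (a - b) * (real q / (real q + 1))"
proof (cases b)
  case 0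
  then show ?thesis using assms by (simp add: local_ratio_def)
next
  case (Suc j)
  define k where "k = a - b"
  have a: "a = Suc j + k" using assms Suc k_def by simp
  have q1: "real q > 1" using prime_gt_1_nat[OF q] by simp
  have "x ^ k * (x / (x + 1)) = (x ^ (2 * a) * (x - 1)) / ((x + 1) * x ^ a * x ^ j * (x - 1))"
    if "x > 1" for x :: real
  proof -
    have "x ^ (2 * a) = x * x ^ k * x ^ a * x ^ j"
      by (simp add: mult_2 power_add) (simp add: a power_add)
    with that show ?thesis by simp
  qed
  from this[OF q1] have "real q ^ k * (real q / (real q + 1)) =
     (real q ^ (2 * a) * (real q - 1)) / ((real q + 1) * real q ^ a * real q ^ j * (real q - 1))" .
  also have "\<dots> \<le> local_ratio q a (Suc j)"
    unfolding local_ratio_Suc[OF q] using q1 by (intro divide_right_mono) auto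
  finally show ?thesis using Suc k_def by simp
qed

lemma local_ratio_ge_if_coprime:
  assumes q: "prime q"
  shows "local_ratio q a 0 \<ge> real q ^ a * ((real q - 1) / (real q + 1))"
proof -
  have q1: "real q > 1" using prime_gt_1_nat[OF q] by simp
  have "real q ^ a * ((real q - 1) / (real q + 1)) = (real q ^ (2 * a) * (real q - 1)) / ((real q + 1) * real q ^ a)"
    using q1 by (simp add: power_mult power2_eq_square power_mult_distrib)
  also have "\<dots> \<le> local_ratio q a 0"
    unfolding local_ratio_coprime[OF q] using q1 by (intro divide_right_mono) auto
  finally show ?thesis .
qed

text \<open>The smaller of the two preceding constants, which makes the bound uniform in
  \<open>b\<close>.\<close>

lemma local_ratio_ge:
  assumes q: "prime q" and "b \<le> a"
  shows "local_ratio q a b \<ge> real q ^ (a - b) * ((real q - 1) / (real q + 1))"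
proof (cases "b > 0")
  case True
  have "real q ^ (a - b) * ((real q - 1) / (real q + 1)) \<le> real q ^ (a - b) * (real q / (real q + 1))"
    by (intro mult_left_mono divide_right_mono) auto
  then show ?thesis using local_ratio_ge_if_dvd[OF assms] True by linarith
qed (use local_ratio_ge_if_coprime[OF q] in auto)

lemma local_ratio_ge_1:
  assumes q: "prime q"
  shows "local_ratio q a 0 \<ge> 1"
  using totient_sq_sum_ge[of "q ^ a"] prime_gt_0_nat[OF q] by (simp add: local_ratio_def divide_simps)

lemma local_ratio_ge_if_le:
  assumes q: "prime q" and "b \<le> a"
  shows "local_ratio q a b \<ge> real q / (real q + 1)"
proof (cases "b > 0")
  case True
  have "1 * (real q / (real q + 1)) \<le> real q ^ (a - b) * (real q / (real q + 1))"
    using prime_gt_0_nat[OF q] by (intro mult_right_mono one_le_power) auto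
  then show ?thesis using local_ratio_ge_if_dvd[OF assms] True by linarith
next
  case False
  have "real q / (real q + 1) \<le> 1" by (simp add: divide_le_eq)
  then show ?thesis using local_ratio_ge_1[OF q, of a] False order_trans by blast
qed

text \<open>Meant for the largest prime divisor \<open>p\<close> of \<open>n\<close>: together with
  the bound \<open>2 / p\<close> for the smaller primes it pushes the whole ratio up to 1.\<close>

lemma local_ratio_ge_half:
  assumes q: "prime q" and "b < a"
  shows "local_ratio q a b \<ge> real q / 2"
proof -
  have q2: "real q \<ge> 2" using prime_ge_2_nat[OF q] by simp
  consider "b > 0" | "b = 0" "a = 1" | "b = 0" "a \<ge> 2" using assms(2) by linarith
  then show ?thesis
  proof cases
    case 1
    have "real q / 2 \<le> real q ^ 1 * (real q / (real q + 1))"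
      using q2 by (simp add: field_simps)
    also have "\<dots> \<le> real q ^ (a - b) * (real q / (real q + 1))"
      using q2 assms(2) by (intro mult_right_mono power_increasing) auto
    also have "\<dots> \<le> local_ratio q a b"
      using local_ratio_ge_if_dvd[OF q] assms(2) 1 by simp
    finally show ?thesis .
  next
    \<comment> \<open>The summand 2 of the exact formula cannot be dropped here: for
      \<open>q = 2\<close> the claim holds with equality.\<close>
    case 2
    have "x / 2 \<le> (x ^ 2 * (x - 1) + 2) / ((x + 1) * x)" if "x \<ge> 2" for x :: real
    proof -
      have "(x - 2) ^ 2 * (x + 1) \<ge> 0" using that by simp
      then have "x * ((x + 1) * x) \<le> (x ^ 2 * (x - 1) + 2) * 2"
        by (simp add: algebra_simps power2_eq_square)
      then show ?thesis using that by (simp add: pos_le_divide_eq)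
    qed
    from this[OF q2] have "real q / 2 \<le> (real q ^ 2 * (real q - 1) + 2) / ((real q + 1) * real q)" .
    then show ?thesis using local_ratio_coprime[OF q, of a] 2 by simp
  next
    case 3
    have "x / 2 \<le> x ^ 2 * ((x - 1) / (x + 1))" if "x \<ge> 2" for x :: real
    proof -
      have "0 \<le> x * ((x - 2) * (2 * x + 1) + 1)" using that by simp
      then have "x * (x + 1) \<le> x ^ 2 * (x - 1) * 2"
        by (simp add: algebra_simps power2_eq_square)
      then show ?thesis using that by (simp add: pos_le_divide_eq)
    qed
    from this[OF q2] have "real q / 2 \<le> real q ^ 2 * ((real q - 1) / (real q + 1))" .
    also have "\<dots> \<le> real q ^ a * ((real q - 1) / (real q + 1))"
      using q2 3 by (intro mult_right_mono power_increasing) auto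
    also have "\<dots> \<le> local_ratio q a b"
      using local_ratio_ge_if_coprime[OF q] 3 by simp
    finally show ?thesis .
  qed
qed

section \<open>Telescoping bounds for products over primes\<close>

text \<open>Over all integers from 2 to \<open>N - 1\<close> the product telescopes to
  \<open>2 / N\<close>; leaving out the composite ones only enlarges it.\<close>

lemma prod_prime_ratio_ge:
  "N \<ge> 2 \<Longrightarrow> (\<Prod>q | prime q \<and> q < N. real q / (real q + 1)) \<ge> 2 / real N"
proof (induction N rule: nat_induct_at_least)
  case base
  have eq: "{q::nat. prime q \<and> q < 2} = {}" by (auto dest: prime_ge_2_nat)
  show ?case unfolding eq by simp
next
  case (Suc N)
  let ?B = "\<lambda>N. {q::nat. prime q \<and> q < N}"
  show ?case
  proof (cases "prime N")
    case True
    then have "?B (Suc N) = insert N (?B N)" by auto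
    then have "(\<Prod>q\<in>?B (Suc N). real q / (real q + 1)) = real N / (real N + 1) * (\<Prod>q\<in>?B N. real q / (real q + 1))"
      by simp
    also have "\<dots> \<ge> real N / (real N + 1) * (2 / real N)"
      using Suc.IH by (intro mult_left_mono) auto
    finally show ?thesis using Suc.hyps by (simp add: add.commute)
  next
    case False
    then have "?B (Suc N) = ?B N" using less_Suc_eq by auto
    moreover have "2 / real (Suc N) \<le> 2 / real N" using Suc.hyps by (intro divide_left_mono) auto
    ultimately show ?thesis using Suc.IH by simp
  qed
qed

text \<open>Collects the constants of \<open>local_ratio_ge\<close>. The primes 2 and 3 are left out
  because their constants have to be sharpened; the remaining primes are odd, so the product can be
  compared with one that telescopes in steps of two.\<close>

definition prime_prod_from_5 :: "nat \<Rightarrow> real" where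
  "prime_prod_from_5 N = (\<Prod>q | prime q \<and> 5 \<le> q \<and> q < N. (real q - 1) / (real q + 1))"

lemma prime_prod_from_5_nonneg: "prime_prod_from_5 N \<ge> 0"
  unfolding prime_prod_from_5_def by (intro prod_nonneg) auto

lemma prime_prod_from_5_add_2:
  assumes "odd N" "N \<ge> 5"
  shows "prime_prod_from_5 (N + 2) = (if prime N then (real N - 1) / (real N + 1) * prime_prod_from_5 N else prime_prod_from_5 N)"
proof -
  have "\<not> prime (N + 1)" using assms prime_odd_nat[of "N + 1"] by auto
  then have eq: "{q. prime q \<and> 5 \<le> q \<and> q < N + 2}
      = (if prime N then insert N else id) {q. prime q \<and> 5 \<le> q \<and> q < N}"
    using assms by (auto simp: numeral_2_eq_2 less_Suc_eq)
  show ?thesis unfolding prime_prod_from_5_def eq by simp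
qed

text \<open>Letting every odd number from \<open>N\<close> on contribute its factor
  \<open>(k-1)/(k+1)\<close>, prime or not, gives a telescoping lower bound.\<close>

lemma prime_prod_from_5_ge:
  assumes "odd N" "N \<ge> 5"
  shows "prime_prod_from_5 (N + 2 * j) \<ge> prime_prod_from_5 N * (real N - 1) / (real (N + 2 * j) - 1)"
proof (induction j)
  case 0
  then show ?case using assms by simp
next
  case (Suc j)
  let ?K = "N + 2 * j"
  have K: "odd ?K" "?K \<ge> 5" using assms by auto
  have "prime_prod_from_5 N * (real N - 1) / (real (?K + 2) - 1)
      = (real ?K - 1) / (real ?K + 1) * (prime_prod_from_5 N * (real N - 1) / (real ?K - 1))"
    using K(2) by (simp add: add.commute)
  also have "\<dots> \<le> (real ?K - 1) / (real ?K + 1) * prime_prod_from_5 ?K"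
    using Suc K(2) by (intro mult_left_mono) auto
  also have "\<dots> \<le> prime_prod_from_5 (?K + 2)"
    using mult_right_mono[OF _ prime_prod_from_5_nonneg, of "(real ?K - 1) / (real ?K + 1)" 1 ?K] K(2)
    unfolding prime_prod_from_5_add_2[OF K] by (simp add: divide_le_eq)
  finally show ?case by (simp add: algebra_simps)
qed

lemma prime_11_13_17_19: "prime (11::nat)" "prime (13::nat)" "prime (17::nat)" "prime (19::nat)"
  by (simp_all add: prime_nat_numeral_eq)

lemma prime_prod_from_5_values:
  "prime_prod_from_5 5 = 1" "prime_prod_from_5 7 = 2/3" "prime_prod_from_5 11 = 1/2" "prime_prod_from_5 13 = 5/12"
  "prime_prod_from_5 17 = 5/14" "prime_prod_from_5 19 = 20/63" "prime_prod_from_5 23 = 2/7"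
proof -
  have *: "\<not> prime (9::nat)" "\<not> prime (15::nat)" "\<not> prime (21::nat)"
    by (simp_all add: prime_nat_numeral_eq)
  show 5: "prime_prod_from_5 5 = 1"
  proof -
    have eq: "{q::nat. prime q \<and> 5 \<le> q \<and> q < 5} = {}" by auto
    show ?thesis unfolding prime_prod_from_5_def eq by simp
  qed
  show 7: "prime_prod_from_5 7 = 2/3" using prime_prod_from_5_add_2[of 5] 5 by simp
  have 9: "prime_prod_from_5 9 = 1/2" using prime_prod_from_5_add_2[of 7] 7 by simp
  show 11: "prime_prod_from_5 11 = 1/2" using prime_prod_from_5_add_2[of 9] 9 * by simp
  show 13: "prime_prod_from_5 13 = 5/12" using prime_prod_from_5_add_2[of 11] 11 prime_11_13_17_19 by simp
  have 15: "prime_prod_from_5 15 = 5/14" using prime_prod_from_5_add_2[of 13] 13 prime_11_13_17_19 by simp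
  show 17: "prime_prod_from_5 17 = 5/14" using prime_prod_from_5_add_2[of 15] 15 * by simp
  show 19: "prime_prod_from_5 19 = 20/63" using prime_prod_from_5_add_2[of 17] 17 prime_11_13_17_19 by simp
  have 21: "prime_prod_from_5 21 = 2/7" using prime_prod_from_5_add_2[of 19] 19 prime_11_13_17_19 by simp
  show 23: "prime_prod_from_5 23 = 2/7" using prime_prod_from_5_add_2[of 21] 21 * by simp
qed

lemma prime_ge_5_cases:
  fixes p :: nat
  assumes "prime p" "p \<ge> 5"
  shows "p \<in> {5, 7, 11, 13, 17, 19} \<or> p \<ge> 23"
proof (rule ccontr)
  assume *: "\<not> ?thesis"
  have "odd p" using assms prime_odd_nat by simp
  moreover have "p < 23" "p \<noteq> 5" "p \<noteq> 7" "p \<noteq> 11" "p \<noteq> 13" "p \<noteq> 17" "p \<noteq> 19" using * by auto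
  ultimately have "p = 9 \<or> p = 15 \<or> p = 21"
    using assms(2) by presburger
  then show False using assms(1) by (auto simp: prime_nat_numeral_eq)
qed

section \<open>The local factors below the largest prime, and the index bound\<close>

text \<open>The uniform bounds only give \<open>c = 1/3 * 1/2 = 1/6\<close>. The sharper formulas
  improve this to \<open>1/4\<close>, except when \<open>b2 = b3 = 0\<close>, \<open>a2 >= 2\<close>
  and \<open>a3 > 0\<close>; but then the power product is divisible by 12 or 24, which makes up for
  the smaller constant.\<close>

lemma local_ratio_2_3:
  assumes "b2 \<le> a2" "b3 \<le> a3"
  obtains c :: real where
    "local_ratio 2 a2 b2 * local_ratio 3 a3 b3 \<ge> real (2 ^ (a2 - b2) * 3 ^ (a3 - b3)) * c"
    "c = 1/4 \<or> c = 3/16 \<and> 12 dvd (2 ^ (a2 - b2) * 3 ^ (a3 - b3) :: nat)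
      \<or> c = 1/6 \<and> 24 dvd (2 ^ (a2 - b2) * 3 ^ (a3 - b3) :: nat)"
proof -
  have combine: "local_ratio 2 a2 b2 * local_ratio 3 a3 b3 \<ge> real (2 ^ (a2 - b2) * 3 ^ (a3 - b3)) * (c2 * c3)"
    if "local_ratio 2 a2 b2 \<ge> 2 ^ (a2 - b2) * c2" "local_ratio 3 a3 b3 \<ge> 3 ^ (a3 - b3) * c3" "c2 \<ge> 0" "c3 \<ge> 0"
    for c2 c3 :: real
  proof -
    have "2 ^ (a2 - b2) * c2 * (3 ^ (a3 - b3) * c3) \<le> local_ratio 2 a2 b2 * local_ratio 3 a3 b3"
      using that local_ratio_nonneg by (intro mult_mono) simp_all
    then show ?thesis by (simp add: mult_ac)
  qed
  have lr2: "local_ratio 2 a2 b2 \<ge> 2 ^ (a2 - b2) * (1/3)" and lr3: "local_ratio 3 a3 b3 \<ge> 3 ^ (a3 - b3) * (1/2)"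
    using local_ratio_ge[of 2 b2 a2] local_ratio_ge[of 3 b3 a3] assms by simp_all
  consider "b2 > 0 \<or> a2 = 0" | "b3 > 0 \<or> a3 = 0" | "b2 = 0" "a2 = 1"
    | "b2 = 0" "a2 = 2" "b3 = 0" "a3 > 0" | "b2 = 0" "a2 \<ge> 3" "b3 = 0" "a3 > 0"
  proof -
    have "a2 = 0 \<or> a2 = 1 \<or> a2 = 2 \<or> a2 \<ge> 3" by linarith
    moreover have "b2 = 0 \<or> b2 > 0" "b3 = 0 \<or> b3 > 0" "a3 = 0 \<or> a3 > 0" by auto
    ultimately show thesis using that by blast
  qed
  then show thesis
  proof cases
    case 1
    have "(2 ^ (a2 - b2) :: real) \<ge> 0" by simp
    moreover have "local_ratio 2 a2 b2 \<ge> 2 ^ (a2 - b2) * (2/3)"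
      using local_ratio_ge_if_dvd[of 2 b2 a2] 1 assms(1) by simp
    ultimately have "local_ratio 2 a2 b2 \<ge> 2 ^ (a2 - b2) * (1/2)" by linarith
    from combine[OF this lr3] show ?thesis by (intro that[of "1/4"]) simp_all
  next
    case 2
    have "local_ratio 3 a3 b3 \<ge> 3 ^ (a3 - b3) * (3/4)"
      using local_ratio_ge_if_dvd[of 3 b3 a3] 2 assms(2) by simp
    from combine[OF lr2 this] show ?thesis by (intro that[of "1/4"]) simp_all
  next
    case 3
    have "local_ratio 2 a2 b2 \<ge> 2 ^ (a2 - b2) * (1/2)"
      using local_ratio_coprime[of 2 a2] 3 by simp
    from combine[OF this lr3] show ?thesis by (intro that[of "1/4"]) simp_all
  next
    case 4
    have "local_ratio 2 a2 b2 \<ge> 2 ^ (a2 - b2) * (3/8)"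
      using local_ratio_coprime[of 2 a2] 4 by simp
    moreover have "4 * 3 dvd (2 ^ (a2 - b2) * 3 ^ (a3 - b3) :: nat)"
      using 4 by (intro mult_dvd_mono) (auto intro: dvd_power)
    ultimately show ?thesis using combine[OF _ lr3, of "3/8"] by (intro that[of "3/16"]) simp_all
  next
    case 5
    have "(2 ^ 3 * 3 :: nat) dvd 2 ^ (a2 - b2) * 3 ^ (a3 - b3)"
      using 5 by (intro mult_dvd_mono le_imp_power_dvd) (auto intro: dvd_power)
    then show ?thesis using combine[OF lr2 lr3] by (intro that[of "1/6"]) simp_all
  qed
qed

text \<open>For large \<open>p\<close> telescoping over the odd numbers suffices; the divisibility conditions on \<open>M\<close> are
  needed for \<open>p \<le> 13\<close> only, e.g. \<open>c = 1/6\<close> would fail for \<open>p = 5\<close>, \<open>M = 6\<close>.\<close>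
lemma constant_times_prime_prod_from_5_ge:
  fixes M p :: nat and c :: real
  assumes "prime p" "p \<ge> 5" "M \<ge> p + 1"
    and c: "c = 1/4 \<or> c = 3/16 \<and> 12 dvd M \<or> c = 1/6 \<and> 24 dvd M"
  shows "real M * c * prime_prod_from_5 p \<ge> (real p + 1) / real p"
proof -
  have odd: "odd p" using assms prime_odd_nat by simp
  have "(real p + 1) / real p \<le> (real p + 1) / (real p - 1)"
    using assms(2) by (intro divide_left_mono) auto
  \<comment> \<open>Given \<open>M >= p + 1\<close>, a constant \<open>1/k\<close> is balanced by a
    lower bound \<open>k / (p - 1)\<close> for the prime product. Telescoping from 5 supplies
    \<open>k = 4\<close>, telescoping from 23 supplies \<open>k = 6\<close>.\<close>
  moreover have "real (p + 1) * (1/k) * (k / (real p - 1)) = (real p + 1) / (real p - 1)" if "k \<noteq> 0" for k :: real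
    using that by simp
  from this[of 4] this[of 6]
  have "real (p + 1) * (1/4) * (4 / (real p - 1)) = (real p + 1) / (real p - 1)"
    "real (p + 1) * (1/6) * (6 / (real p - 1)) = (real p + 1) / (real p - 1)"
    by (simp_all only: zero_neq_numeral[symmetric] simp_thms)
  ultimately have frac: "(real p + 1) / real p \<le> real (p + 1) * (1/4) * (4 / (real p - 1))"
    "(real p + 1) / real p \<le> real (p + 1) * (1/6) * (6 / (real p - 1))" by (simp_all only:)
  have *: ?thesis if "real M' * c' * w \<ge> (real p + 1) / real p" "M' \<le> M" "c' \<le> c" "w \<le> prime_prod_from_5 p" "w \<ge> 0" "c' \<ge> 0" for M' c' w
  proof -
    have "real M' * c' * w \<le> real M * c * prime_prod_from_5 p"
      using that(2-) prime_prod_from_5_nonneg[of p] by (intro mult_mono) simp_all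
    with that(1) show ?thesis by (rule order_trans)
  qed
  consider "c = 1/4" | "c \<ge> 1/6" "p \<ge> 23" | "c \<ge> 1/6" "p = 17 \<or> p = 19"
    | "p \<in> {5, 7, 11, 13}" "c = 3/16" "12 dvd M" | "p \<in> {5, 7, 11, 13}" "c = 1/6" "24 dvd M"
  proof -
    have "p = 17 \<or> p = 19 \<or> p \<in> {5, 7, 11, 13} \<or> p \<ge> 23" using prime_ge_5_cases[OF assms(1,2)] by blast
    moreover have "c = 1/4 \<or> c = 3/16 \<and> 12 dvd M \<and> c \<ge> 1/6 \<or> c = 1/6 \<and> 24 dvd M \<and> c \<ge> 1/6" using c by auto
    ultimately show thesis using that by blast
  qed
  then show ?thesis
  proof cases
    case 1
    have "even (p - 5)" using odd assms(2) by simp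
    then obtain j where "p - 5 = 2 * j" by (elim evenE)
    then have j: "p = 5 + 2 * j" using assms(2) by simp
    have w: "4 / (real p - 1) \<le> prime_prod_from_5 p"
      using prime_prod_from_5_ge[of 5 j] prime_prod_from_5_values(1) j by simp
    show ?thesis
      by (rule *[OF frac(1)]) (use w assms(2,3) 1 in simp_all)
  next
    case 2
    have "even (p - 23)" using odd 2(2) by simp
    then obtain j where "p - 23 = 2 * j" by (elim evenE)
    then have j: "p = 23 + 2 * j" using 2(2) by simp
    \<comment> \<open>The numerator is \<open>22 * 2/7 = 44/7\<close>, just above 6.\<close>
    have "6 / (real p - 1) \<le> prime_prod_from_5 23 * 22 / (real p - 1)"
      using prime_prod_from_5_values(7) 2 by (intro divide_right_mono) auto
    then have w: "6 / (real p - 1) \<le> prime_prod_from_5 p"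
      using prime_prod_from_5_ge[of 23 j] j by simp
    show ?thesis
      by (rule *[OF frac(2)]) (use w assms(2,3) 2 in simp_all)
  next
    case 3
    \<comment> \<open>Telescoping from 5 is too weak here, but the exact values suffice:
      \<open>15/14 >= 18/17\<close> for 17 and \<open>200/189 >= 20/19\<close> for 19.\<close>
    show ?thesis
      by (rule *[of "p + 1" "1/6" "prime_prod_from_5 p"]) (use assms(3) 3 prime_prod_from_5_values(5,6) in auto)
  next
    case 4
    \<comment> \<open>For \<open>p = 13\<close> the bound 12 alone is too small, as
      \<open>12 * 3/16 * 5/12 < 1\<close>; hence the maximum with \<open>p + 1\<close>.\<close>
    have "M \<ge> 12" using dvd_imp_le[OF 4(3)] assms by simp
    then show ?thesis
      by (intro *[of "max 12 (p + 1)" "3/16" "prime_prod_from_5 p"]) (use assms(3) 4 prime_prod_from_5_values(1-4) in auto)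
  next
    case 5
    have "M \<ge> 24" using dvd_imp_le[OF 5(3)] assms by simp
    then show ?thesis
      by (intro *[of 24 "1/6" "prime_prod_from_5 p"]) (use 5 prime_prod_from_5_values(1-4) in auto)
  qed
qed

text \<open>The target \<open>(p+1)/p\<close> is the inverse of the least value guaranteed for the
  factor at \<open>p\<close> itself. For \<open>p = 2\<close> the hypothesis on the empty product is
  absurd, for \<open>p = 3\<close> only the prime 2 occurs, and from 5 on the primes 2 and 3 are
  treated jointly and the others by the uniform bound.\<close>

lemma prod_local_ratio_ge:
  fixes p :: nat and a b :: "nat \<Rightarrow> nat"
  assumes "prime p" and ba: "\<And>q. b q \<le> a q"
    and M: "(\<Prod>q | prime q \<and> q < p. q ^ (a q - b q)) \<ge> p + 1"
  shows "(\<Prod>q | prime q \<and> q < p. local_ratio q (a q) (b q)) \<ge> (real p + 1) / real p"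
proof -
  let ?B = "{q. prime q \<and> q < p}"
  consider "p = 2" | "p = 3" | "p \<ge> 5"
  proof -
    have "p = 2 \<or> p = 3 \<or> p = 4 \<or> p \<ge> 5" using prime_ge_2_nat[OF assms(1)] by linarith
    moreover have "p \<noteq> 4" using assms(1) by (auto simp: prime_nat_numeral_eq)
    ultimately show thesis using that by blast
  qed
  then show ?thesis
  proof cases
    case 1
    then have eq: "?B = {}" by (auto dest: prime_ge_2_nat)
    show ?thesis using M 1 unfolding eq by simp
  next
    case 2
    have "q = 2" if "prime q" "q < 3" for q :: nat
      using that prime_ge_2_nat[of q] by simp
    then have eq: "?B = {2}" using 2 by auto
    have "(4 :: nat) \<le> 2 ^ (a 2 - b 2)" using M unfolding eq using 2 by simp
    then have "real 4 \<le> real (2 ^ (a 2 - b 2))" by (rule of_nat_mono)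
    then have "4 / 3 \<le> (2 ^ (a 2 - b 2) :: real) * (1 / 3)" by simp
    also have "\<dots> \<le> local_ratio 2 (a 2) (b 2)" using local_ratio_ge[of 2 "b 2" "a 2"] ba by simp
    finally show ?thesis unfolding eq using 2 by simp
  next
    case 3
    let ?C = "{q. prime q \<and> 5 \<le> q \<and> q < p}"
    have B: "?B = insert 2 (insert 3 ?C)"
    proof -
      have small: "q = 2 \<or> q = 3" if "prime q" "q < 5" for q :: nat
      proof -
        have "q = 2 \<or> q = 3 \<or> q = 4" using prime_ge_2_nat[OF that(1)] that(2) by linarith
        moreover have "q \<noteq> 4" using that(1) by (auto simp: prime_nat_numeral_eq)
        ultimately show ?thesis by blast
      qed
      show ?thesis
      proof (intro equalityI subsetI)
        fix q assume "q \<in> ?B"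
        then show "q \<in> insert 2 (insert 3 ?C)" using small[of q] by (cases "q < 5") simp_all
      qed (use 3 in auto)
    qed
    define M5 where "M5 = (\<Prod>q\<in>?C. q ^ (a q - b q))"
    define M23 where "M23 = (2 ^ (a 2 - b 2) * 3 ^ (a 3 - b 3) :: nat)"
    obtain c where c: "local_ratio 2 (a 2) (b 2) * local_ratio 3 (a 3) (b 3) \<ge> real M23 * c"
      "c = 1/4 \<or> c = 3/16 \<and> 12 dvd M23 \<or> c = 1/6 \<and> 24 dvd M23"
      using local_ratio_2_3 ba unfolding M23_def by metis
    have "(real p + 1) / real p \<le> real (M23 * M5) * c * prime_prod_from_5 p"
    proof (rule constant_times_prime_prod_from_5_ge)
      show "M23 * M5 \<ge> p + 1" using M unfolding B M23_def M5_def by simp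
    qed (use assms 3 c in auto)
    also have "\<dots> = (real M23 * c) * (real M5 * prime_prod_from_5 p)" by simp
    also have "\<dots> \<le> (local_ratio 2 (a 2) (b 2) * local_ratio 3 (a 3) (b 3)) * (\<Prod>q\<in>?C. local_ratio q (a q) (b q))"
    proof (rule mult_mono)
      have "real M5 * prime_prod_from_5 p = (\<Prod>q\<in>?C. real q ^ (a q - b q) * ((real q - 1) / (real q + 1)))"
        unfolding M5_def prime_prod_from_5_def of_nat_prod of_nat_power prod.distrib ..
      also have "\<dots> \<le> (\<Prod>q\<in>?C. local_ratio q (a q) (b q))"
        using local_ratio_ge ba by (intro prod_mono) auto
      finally show "real M5 * prime_prod_from_5 p \<le> (\<Prod>q\<in>?C. local_ratio q (a q) (b q))" .
    qed (use c prime_prod_from_5_nonneg in \<open>auto simp: local_ratio_nonneg\<close>)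
    finally show ?thesis unfolding B by simp
  qed
qed

text \<open>The hypothesis \<open>large\<close> says that the product of all local factors is below
  1. An index of at least \<open>p\<close> would force that product to be at least 1.\<close>

lemma index_less_largest_prime:
  fixes n d p :: nat
  assumes "n > 0" "d dvd n" "prime p" "p dvd n" and p_max: "\<And>q. prime q \<Longrightarrow> q dvd n \<Longrightarrow> q \<le> p"
    and large: "totient_sq_sum n < n * totient d"
  shows "n div d < p"
proof (rule ccontr)
  assume not: "\<not> n div d < p"
  define a b where "a = (\<lambda>q. multiplicity q n)" and "b = (\<lambda>q. multiplicity q d)"
  have "d > 0" using assms(1,2) by (rule dvd_pos_nat)
  have ba: "b q \<le> a q" for q unfolding a_def b_def using assms(1,2) by (intro dvd_imp_multiplicity_le) auto
  let ?B = "{q. prime q \<and> q < p}"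
  define F where "F = (\<lambda>q. local_ratio q (a q) (b q))"
  have F0: "F q \<ge> 0" for q unfolding F_def by (rule local_ratio_nonneg)
  have fin: "finite (insert p ?B)" by simp
  have primes: "prime q" if "q \<in> insert p ?B" for q using that assms(3) by auto
  have sub: "prime_factors n \<subseteq> insert p ?B"
    using p_max by (auto simp: in_prime_factors_iff order_le_less)
  have sub': "prime_factors d \<subseteq> insert p ?B" using sub dvd_prime_factors[of n d] assms(1,2) by auto
  have "real (totient_sq_sum n) / (real n * real (totient d)) = (\<Prod>q\<in>insert p ?B. F q)"
    unfolding F_def a_def b_def using assms(1,2) fin primes sub by (rule ratio_eq_prod_local_ratio)
  moreover have "real (totient_sq_sum n) / (real n * real (totient d)) < 1"
    using large assms(1) \<open>d > 0\<close> by (simp add: flip: of_nat_mult)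
  ultimately have lt1: "F p * (\<Prod>q\<in>?B. F q) < 1" by simp
  have p2: "p \<ge> 2" using assms(3) by (rule prime_ge_2_nat)
  \<comment> \<open>Otherwise the factor at \<open>p\<close> is at least \<open>p / 2\<close> and
    the smaller primes contribute at least \<open>2 / p\<close>.\<close>
  have "b p = a p"
  proof (rule ccontr)
    assume "b p \<noteq> a p"
    then have Fp: "F p \<ge> real p / 2" unfolding F_def using ba assms(3) by (intro local_ratio_ge_half) (auto simp: order_less_le)
    have "2 / real p \<le> (\<Prod>q\<in>?B. real q / (real q + 1))" using p2 by (rule prod_prime_ratio_ge)
    also have "\<dots> \<le> (\<Prod>q\<in>?B. F q)"
      unfolding F_def using ba by (intro prod_mono) (auto intro: local_ratio_ge_if_le)
    finally have "real p / 2 * (2 / real p) \<le> F p * (\<Prod>q\<in>?B. F q)"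
      using Fp F0 by (intro mult_mono) auto
    then show False using lt1 p2 by simp
  qed
  define M where "M = (\<Prod>q\<in>?B. q ^ (a q - b q))"
  have n: "n = (\<Prod>q\<in>insert p ?B. q ^ a q)"
    unfolding a_def using assms(1) fin primes sub by (rule prime_power_decomposition)
  have d: "d = (\<Prod>q\<in>insert p ?B. q ^ b q)"
    unfolding b_def using \<open>d > 0\<close> fin primes sub' by (rule prime_power_decomposition)
  have "(\<Prod>q\<in>insert p ?B. q ^ a q) = (\<Prod>q\<in>insert p ?B. q ^ b q * q ^ (a q - b q))"
    using ba by (intro prod.cong refl) (simp flip: power_add)
  also have "\<dots> = d * M"
    unfolding prod.distrib d[symmetric] M_def using \<open>b p = a p\<close> by simp
  finally have "n = d * M" unfolding n[symmetric] .
  then have M: "n div d = M" using \<open>d > 0\<close> by simp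
  \<comment> \<open>The index now involves only primes below \<open>p\<close>, which improves
    \<open>M >= p\<close> to the required \<open>M >= p + 1\<close>.\<close>
  have "M \<noteq> p"
  proof
    assume "M = p"
    then obtain q where "q \<in> ?B" "p dvd q ^ (a q - b q)"
      unfolding M_def using assms(3) by (metis (no_types, lifting) dvd_refl fin finite_insert prime_dvd_prod_iff)
    then show False using assms(3) prime_dvd_power primes_dvd_imp_eq by blast
  qed
  then have "M \<ge> p + 1" using not M by simp
  then have "(\<Prod>q\<in>?B. F q) \<ge> (real p + 1) / real p"
    unfolding F_def M_def using assms(3) ba by (intro prod_local_ratio_ge) auto
  moreover have "F p \<ge> real p / (real p + 1)"
    unfolding F_def using assms(3) ba by (rule local_ratio_ge_if_le)
  ultimately have "real p / (real p + 1) * ((real p + 1) / real p) \<le> F p * (\<Prod>q\<in>?B. F q)"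
    using F0 by (intro mult_mono) auto
  then show False using lt1 p2 by simp
qed

section \<open>Totients of element orders in cyclic subgroups\<close>

definition totient_ord_sum :: "('a, 'm) monoid_scheme \<Rightarrow> nat" where
  "totient_ord_sum G = (\<Sum>x\<in>carrier G. totient (group.ord G x))"

lemma div_dvd_self: "d dvd n \<Longrightarrow> n div d dvd n" for d n :: nat
  by (metis dvd_div_mult_self dvd_triv_left)

lemma div_div_self: "d dvd n \<Longrightarrow> n > 0 \<Longrightarrow> n div (n div d) = d" for d n :: nat
  by (elim dvdE) simp

text \<open>\<open>N div gcd i N\<close> is the order of the \<open>i\<close>-th power of an element
  of order \<open>N\<close>. Grouping the exponents by this value \<open>e\<close> yields
  \<open>totient e\<close> exponents for each divisor \<open>e\<close>.\<close>

lemma sum_totient_div_gcd: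
  assumes "N > 0"
  shows "(\<Sum>i\<in>{0<..N}. totient (N div gcd i N)) = totient_sq_sum N"
proof -
  have "(\<Sum>e | e dvd N. \<Sum>i\<in>{i \<in> {0<..N}. N div gcd i N = e}. totient (N div gcd i N))
      = (\<Sum>i\<in>{0<..N}. totient (N div gcd i N))"
    using assms by (intro sum.group) (auto intro: div_dvd_self)
  moreover have "(\<Sum>i\<in>{i \<in> {0<..N}. N div gcd i N = e}. totient (N div gcd i N)) = totient e ^ 2"
    if e: "e dvd N" for e
  proof -
    have "N div gcd i N = e \<longleftrightarrow> gcd i N = N div e" for i
    proof
      assume "N div gcd i N = e"
      then show "gcd i N = N div e" using div_div_self[of "gcd i N" N] assms by simp
    next
      assume "gcd i N = N div e"
      then show "N div gcd i N = e" using div_div_self[OF e] assms by simp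
    qed
    then have "card {i \<in> {0<..N}. N div gcd i N = e} = card {i \<in> {0<..N}. gcd i N = N div e}"
      by simp
    also have "\<dots> = totient (N div (N div e))"
      using e assms by (intro card_gcd_eq_totient) (simp_all add: div_dvd_self)
    also have "N div (N div e) = e" using e assms by (rule div_div_self)
    finally show ?thesis by (simp add: power2_eq_square)
  qed
  ultimately show ?thesis unfolding totient_sq_sum_def by simp
qed

context group
begin

lemma nat_pow_cong:
  assumes "x \<in> carrier G" "[m = n] (mod ord x)"
  shows "x [^] m = x [^] (n :: nat)"
proof -
  have *: "x [^] m = x [^] n" if "n \<le> m" "[m = n] (mod ord x)" for m n :: nat
  proof -
    have "\<exists>q. m = q * ord x + n"
      using that cong_le_nat[of n m "ord x"] by simp
    then obtain q where "m = q * ord x + n" ..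
    then have "m = n + ord x * q" by simp
    then show ?thesis using assms(1)
      by (simp flip: nat_pow_mult nat_pow_pow)
  qed
  show ?thesis using *[of n m] *[of m n] assms(2) by (cases "n \<le> m") (auto simp: cong_sym)
qed

text \<open>Exponents start at 1 and include \<open>ord w\<close>, to match \<open>totatives\<close>
  and \<open>sum_totient_div_gcd\<close>.\<close>

lemma generate_singleton_eq_image:
  assumes "finite (carrier G)" "w \<in> carrier G"
  shows "generate G {w} = (\<lambda>i::nat. w [^] i) ` {0<..ord w}"
proof -
  have inj: "inj_on (\<lambda>i::nat. w [^] i) {0<..ord w}"
    using ord_inj'[OF assms(2)] by (simp add: atLeastSucAtMost_greaterThanAtMost)
  have sub: "(\<lambda>i::nat. w [^] i) ` {0<..ord w} \<subseteq> generate G {w}"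
    using generate_pow_on_finite_carrier[OF assms] by auto
  have fin: "finite (generate G {w})"
    using assms generate_incl[of "{w}"] by (auto intro: finite_subset)
  show ?thesis
    using card_subset_eq[OF fin sub] card_image[OF inj] generate_pow_card[OF assms(2)] by simp
qed

lemma sum_generate_totient_ord:
  assumes "finite (carrier G)" "w \<in> carrier G"
  shows "(\<Sum>u\<in>generate G {w}. totient (ord u)) = totient_sq_sum (ord w)"
proof -
  have inj: "inj_on (\<lambda>i::nat. w [^] i) {0<..ord w}"
    using ord_inj'[OF assms(2)] by (simp add: atLeastSucAtMost_greaterThanAtMost)
  have "(\<Sum>u\<in>generate G {w}. totient (ord u)) = (\<Sum>i\<in>{0<..ord w}. totient (ord (w [^] i)))"
    unfolding generate_singleton_eq_image[OF assms] by (subst sum.reindex[OF inj]) simp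
  also have "\<dots> = (\<Sum>i\<in>{0<..ord w}. totient (ord w div gcd i (ord w)))"
    by (intro sum.cong refl) (auto simp: ord_pow_gen[OF assms(2)] gcd.commute)
  finally show ?thesis using sum_totient_div_gcd[of "ord w"] ord_ge_1[OF assms] by simp
qed

lemma card_generators:
  assumes "finite (carrier G)" "w \<in> carrier G"
  shows "card {u \<in> generate G {w}. ord u = ord w} = totient (ord w)"
proof -
  have inj: "inj_on (\<lambda>i::nat. w [^] i) {0<..ord w}"
    using ord_inj'[OF assms(2)] by (simp add: atLeastSucAtMost_greaterThanAtMost)
  have "{u \<in> generate G {w}. ord u = ord w} = (\<lambda>i::nat. w [^] i) ` totatives (ord w)"
    unfolding generate_singleton_eq_image[OF assms]
    by (auto simp: totatives_def pow_ord_eq_ord_iff[OF assms])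
  moreover have "inj_on (\<lambda>i::nat. w [^] i) (totatives (ord w))"
    using inj totatives_subset by (rule inj_on_subset)
  ultimately show ?thesis by (simp add: card_image totient_def)
qed

text \<open>A subgroup contained in a finite subgroup of the same size equals it. This turns mutual
  generation into the condition counted by \<open>card_generators\<close>.\<close>

lemma mutual_generate_iff:
  assumes fin: "finite (carrier G)" and "g \<in> carrier G" "h \<in> carrier G"
  shows "h \<in> generate G {g} \<and> g \<in> generate G {h} \<longleftrightarrow> h \<in> generate G {g} \<and> ord h = ord g"
proof -
  have sub: "generate G {y} \<subseteq> generate G {x}" if "x \<in> carrier G" "y \<in> generate G {x}" for x y
    using that generate_subgroup_incl[of "{y}" "generate G {x}"] generate_is_subgroup[of "{x}"] by simp
  have fin': "finite (generate G {x})" if "x \<in> carrier G" for x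
    using that fin generate_incl[of "{x}"] by (auto intro: finite_subset)
  have card: "ord x = card (generate G {x})" if "x \<in> carrier G" for x
    using generate_pow_card[OF that] .
  show ?thesis
  proof safe
    assume "h \<in> generate G {g}" "g \<in> generate G {h}"
    then have "generate G {h} = generate G {g}" using sub assms by blast
    then show "ord h = ord g" using card assms by simp
  next
    assume "h \<in> generate G {g}" "ord h = ord g"
    then have "generate G {h} = generate G {g}"
      using card_subset_eq[OF fin'[of g] sub[of g h]] card assms by simp
    then show "g \<in> generate G {h}" using generate.incl[of g "{g}" G] by simp
  qed
qed

section \<open>Normality from a small index\<close>

lemma conj_nat_pow:
  assumes "g \<in> carrier G" "u \<in> carrier G"
  shows "(g \<otimes> u \<otimes> inv g) [^] (n :: nat) = g \<otimes> u [^] n \<otimes> inv g"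
proof (induction n)
  case (Suc n)
  have "g \<otimes> u [^] n \<otimes> inv g \<otimes> (g \<otimes> u \<otimes> inv g) = g \<otimes> (u [^] n \<otimes> ((inv g \<otimes> g) \<otimes> (u \<otimes> inv g)))"
    using assms by (simp only: m_assoc inv_closed m_closed nat_pow_closed)
  also have "\<dots> = g \<otimes> (u [^] n \<otimes> u) \<otimes> inv g" using assms by (simp add: m_assoc)
  finally show ?case using Suc by simp
qed (use assms in simp)

text \<open>The powers of \<open>u\<close> of exponent less than \<open>p\<close> cannot move a coset of \<open>\<langle>x\<rangle>\<close> to \<open>p\<close> different ones,
  so every conjugate of \<open>u\<close> lies in the cyclic group \<open>\<langle>x\<rangle>\<close>, which has only one subgroup of order \<open>p ^ k\<close>.\<close>
lemma normal_generate_of_small_index: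
  assumes fin: "finite (carrier G)" and x: "x \<in> carrier G" and p: "prime p"
    and index: "order G div ord x < p" and pk: "p ^ k dvd ord x"
  defines "u \<equiv> x [^] (ord x div p ^ k)"
  shows "generate G {u} \<lhd> G" "ord u = p ^ k"
proof -
  have N: "ord x > 0" using ord_ge_1[OF fin x] by simp
  then have q: "ord x div p ^ k > 0" using pk dvd_div_eq_0_iff[OF pk] by simp
  have u: "u \<in> carrier G" unfolding u_def using x by simp
  show ord_u: "ord u = p ^ k"
    unfolding u_def using ord_pow[OF x div_dvd_self[OF pk]] div_div_self[OF pk N] q by simp
  let ?A = "generate G {x}"
  have A: "subgroup ?A G" using x by (intro generate_is_subgroup) simp
  have pow_A: "v [^] (i::nat) \<in> ?A" if "v \<in> ?A" for v i
    using that A by (induction i) (auto simp: subgroup.one_closed subgroup.m_closed)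
  have conj: "g \<otimes> u \<otimes> inv g \<in> generate G {u}" if g: "g \<in> carrier G" for g
  proof -
    have "card (rcosets ?A) * ord x = order G"
      using lagrange[OF A] generate_pow_card[OF x] by simp
    then have "card (rcosets ?A) < card {..<p}"
      using index N by (metis card_lessThan div_mult_self_is_m)
    \<comment> \<open>There are fewer than \<open>p\<close> cosets, so two of these \<open>p\<close>
      translates coincide.\<close>
    moreover have "(\<lambda>i. ?A #> (g \<otimes> u [^] i)) ` {..<p} \<subseteq> rcosets ?A"
      using g u subgroup.subset[OF A] by (auto intro!: rcosetsI)
    moreover have "finite (rcosets ?A)"
      using fin rcosets_subset_PowG[OF A] by (auto intro: finite_subset)
    ultimately have "\<not> inj_on (\<lambda>i. ?A #> (g \<otimes> u [^] i)) {..<p}"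
      using card_inj_on_le[of "\<lambda>i. ?A #> (g \<otimes> u [^] i)" "{..<p}" "rcosets ?A"] by linarith
    then obtain i j where ij: "i < j" "j < p" "?A #> (g \<otimes> u [^] i) = ?A #> (g \<otimes> u [^] j)"
      unfolding inj_on_def by (metis lessThan_iff linorder_neqE_nat)
    have "g \<otimes> u [^] j \<in> ?A #> (g \<otimes> u [^] i)"
      using ij(3) g u A by (simp add: rcos_self)
    then have "(g \<otimes> u [^] j) \<otimes> inv (g \<otimes> u [^] i) \<in> ?A"
      using g u A subgroup.rcos_module_imp[OF A is_group] by simp
    moreover have "(g \<otimes> u [^] j) \<otimes> inv (g \<otimes> u [^] i) = g \<otimes> u [^] (j - i) \<otimes> inv g"
    proof -
      have "u [^] j = u [^] (j - i) \<otimes> u [^] i" using ij(1) u by (simp add: nat_pow_mult)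
      then show ?thesis using g u by (simp add: inv_mult_group m_assoc[symmetric]) (simp add: m_assoc)
    qed
    ultimately have "(g \<otimes> u \<otimes> inv g) [^] (j - i) \<in> ?A" using g u by (simp add: conj_nat_pow)
    then have *: "(g \<otimes> u \<otimes> inv g) [^] ((j - i) * c) \<in> ?A" for c
      using pow_A[of "(g \<otimes> u \<otimes> inv g) [^] (j - i)" c] g u by (simp add: nat_pow_pow)
    \<comment> \<open>As \<open>0 < j - i < p\<close>, the exponent \<open>j - i\<close> is
      invertible modulo \<open>ord u = p^k\<close>, so \<open>u\<close> is itself a power of
      \<open>u [^] (j - i)\<close>.\<close>
    have "\<not> p dvd j - i" using ij by (auto dest: dvd_imp_le)
    then have "coprime (j - i) (p ^ k)" using p by (simp add: coprime_commute prime_imp_coprime)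
    then obtain c where "[(j - i) * c = Suc 0] (mod p ^ k)" using cong_solve_coprime_nat by blast
    then have "u [^] ((j - i) * c) = u" using nat_pow_cong[OF u] u ord_u by fastforce
    then have "g \<otimes> u \<otimes> inv g \<in> ?A" using *[of c] g u by (simp add: conj_nat_pow)
    then obtain t :: nat where t: "g \<otimes> u \<otimes> inv g = x [^] t"
      using generate_pow_on_finite_carrier[OF fin x] by auto
    \<comment> \<open>The conjugate is killed by \<open>p^k\<close>, which forces \<open>t\<close>
      to be a multiple of \<open>ord x div p^k\<close> and thus \<open>x [^] t\<close> to be a power
      of \<open>u\<close>.\<close>
    have "x [^] (t * p ^ k) = g \<otimes> u [^] p ^ k \<otimes> inv g"
      using g u x t by (simp flip: nat_pow_pow conj_nat_pow)
    also have "\<dots> = \<one>" using g u ord_u[symmetric] by simp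
    finally have "ord x dvd t * p ^ k" using pow_eq_id[OF x] by simp
    then have "ord x div p ^ k dvd t" using pk p by (simp add: div_dvd_iff_mult prime_gt_0_nat)
    then obtain s where "t = ord x div p ^ k * s" by (elim dvdE)
    then have "g \<otimes> u \<otimes> inv g = u [^] s" using t x unfolding u_def by (simp add: nat_pow_pow)
    then show ?thesis using generate_pow_on_finite_carrier[OF fin u] by auto
  qed
  show "generate G {u} \<lhd> G"
    unfolding normal_inv_iff
  proof (intro conjI ballI)
    have sub: "subgroup (generate G {u}) G" using u by (intro generate_is_subgroup) simp
    then show "subgroup (generate G {u}) G" .
    fix g h assume g: "g \<in> carrier G" and "h \<in> generate G {u}"
    then obtain i :: nat where "h = u [^] i" using generate_pow_on_finite_carrier[OF fin u] by auto
    then have "g \<otimes> h \<otimes> inv g = (g \<otimes> u \<otimes> inv g) [^] i" using g u by (simp add: conj_nat_pow)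
    also have "\<dots> \<in> generate G {u}"
      using conj[OF g] sub by (induction i) (auto simp: subgroup.one_closed subgroup.m_closed)
    finally show "g \<otimes> h \<otimes> inv g \<in> generate G {u}" .
  qed
qed

section \<open>Passage to the quotient by a normal cyclic subgroup\<close>

lemma ord_dvd_of_mem_generate:
  assumes fin: "finite (carrier G)" and w: "w \<in> carrier G" and u: "u \<in> generate G {w}"
  shows "ord u dvd ord w"
proof -
  obtain k :: nat where k: "u = w [^] k" using u generate_pow_on_finite_carrier[OF fin w] by auto
  have "u [^] ord w = (w [^] ord w) [^] k" unfolding k using w by (simp only: nat_pow_pow mult.commute)
  then have "u [^] ord w = \<one>" using w by simp
  then show ?thesis using k w pow_eq_id[of u "ord w"] by simp
qed

text \<open>Conjugation by \<open>y\<close> raises the elements of the normal cyclic subgroup to a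
  fixed power \<open>r\<close>. Hence all factors \<open>y\<close> in
  \<open>(u \<otimes> y) [^] d\<close> can be collected on the right, where they vanish, and a power
  of \<open>u\<close> remains.\<close>

lemma ord_mult_normal_cyclic_dvd:
  assumes fin: "finite (carrier G)" and w: "w \<in> carrier G" and normal: "generate G {w} \<lhd> G"
    and u: "u \<in> generate G {w}" and y: "y \<in> carrier G" "y [^] d = \<one>"
  shows "ord (u \<otimes> y) dvd d * ord u"
proof -
  note P = generate_pow_on_finite_carrier[OF fin w]
  have "w \<in> generate G {w}" by (simp add: generate.incl)
  then have "y \<otimes> w \<otimes> inv y \<in> generate G {w}" using normal_invE(2)[OF normal y(1)] by blast
  then obtain r :: nat where r: "y \<otimes> w \<otimes> inv y = w [^] r" using P by auto
  obtain j :: nat where j: "u = w [^] j" using u P by auto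
  have uc: "u \<in> carrier G" using j w by simp
  have conj: "y \<otimes> u [^] s = u [^] (r * s) \<otimes> y" for s :: nat
  proof -
    have "y \<otimes> u [^] s \<otimes> inv y = w [^] (r * (j * s))"
      using j w y r by (simp add: nat_pow_pow flip: conj_nat_pow)
    also have "\<dots> = u [^] (r * s)" using j w by (simp add: nat_pow_pow mult_ac)
    finally have "y \<otimes> u [^] s \<otimes> inv y \<otimes> y = u [^] (r * s) \<otimes> y" by simp
    then show ?thesis using y uc by (simp add: m_assoc)
  qed
  have "\<exists>s::nat. (u \<otimes> y) [^] k = u [^] s \<otimes> y [^] k" for k :: nat
  proof (induction k)
    case 0
    then show ?case by (intro exI[of _ 0]) simp
  next
    case (Suc k)
    then obtain s :: nat where s: "(u \<otimes> y) [^] k = u [^] s \<otimes> y [^] k" by blast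
    have "(u \<otimes> y) [^] Suc k = (u \<otimes> y) \<otimes> (u [^] s \<otimes> y [^] k)"
      using uc y s by (simp only: nat_pow_Suc2 m_closed)
    also have "\<dots> = u \<otimes> (y \<otimes> u [^] s) \<otimes> y [^] k" using uc y by (simp add: m_assoc)
    also have "\<dots> = (u \<otimes> u [^] (r * s)) \<otimes> (y \<otimes> y [^] k)" unfolding conj using uc y by (simp add: m_assoc)
    also have "\<dots> = u [^] Suc (r * s) \<otimes> y [^] Suc k" using uc y by (simp only: nat_pow_Suc2)
    finally show ?case by blast
  qed
  then obtain s :: nat where "(u \<otimes> y) [^] d = u [^] s" using uc y by (metis nat_pow_closed r_one)
  then have "(u \<otimes> y) [^] (d * ord u) = u [^] (s * ord u)"
    using uc y by (simp flip: nat_pow_pow)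
  also have "\<dots> = (u [^] ord u) [^] s"
    using uc by (simp only: nat_pow_pow mult.commute)
  finally have "(u \<otimes> y) [^] (d * ord u) = \<one>" using uc by simp
  then show ?thesis using uc y by (simp add: pow_eq_id)
qed

text \<open>With a representative \<open>y\<close> killed by the order \<open>d\<close> of its
  coset, \<open>ord (u \<otimes> y)\<close> divides \<open>d * ord u\<close>. Since
  \<open>totient\<close> is monotone under divisibility and \<open>d\<close> is coprime to
  \<open>ord u\<close>, the sum over the coset factors.\<close>

lemma totient_ord_sum_le_normal_cyclic:
  assumes fin: "finite (carrier G)" and w: "w \<in> carrier G" and normal: "generate G {w} \<lhd> G"
    and coprime: "coprime (ord w) (order G div ord w)"
  shows "totient_ord_sum G \<le> totient_sq_sum (ord w) * totient_ord_sum (G Mod generate G {w})"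
proof -
  let ?P = "generate G {w}"
  let ?Q = "G Mod ?P"
  interpret P: normal ?P G by (rule normal)
  interpret Q: group ?Q by (rule P.factorgroup_is_group)
  have P: "subgroup ?P G" by (rule P.is_subgroup)
  have N: "ord w > 0" using ord_ge_1[OF fin w] by simp
  have finQ: "finite (rcosets ?P)" using fin rcosets_subset_PowG[OF P] by (auto intro: finite_subset)
  have "card (rcosets ?P) * ord w = order G" using lagrange[OF P] generate_pow_card[OF w] by simp
  then have orderQ: "order ?Q = order G div ord w" using div_mult_self_is_m[OF N, of "card (rcosets ?P)"] by (simp add: order_def FactGroup_def)
  have coset: "(\<Sum>g\<in>C. totient (ord g)) \<le> totient (Q.ord C) * totient_sq_sum (ord w)" if C: "C \<in> rcosets ?P" for C
  proof -
    let ?d = "Q.ord C"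
    have CQ: "C \<in> carrier ?Q" using C by (simp add: FactGroup_def)
    obtain g where g: "g \<in> carrier G" "C = ?P #> g" using C by (auto simp: RCOSETS_def)
    have "?d dvd order G div ord w" using Q.ord_dvd_group_order[OF CQ] orderQ by simp
    then have cop: "coprime ?d (ord w)" using coprime_divisors[OF dvd_refl _ coprime] coprime_commute by blast
    \<comment> \<open>The first congruence keeps \<open>g [^] t\<close> in the coset
      \<open>C\<close>; the second makes its \<open>?d\<close>-th power trivial, because
      \<open>g [^] ?d\<close> lies in \<open>?P\<close>.\<close>
    then obtain t where t: "[t = 1] (mod ?d)" "[t = 0] (mod ord w)"
      using binary_chinese_remainder_nat by blast
    define y where "y = g [^] t"
    have y: "y \<in> carrier G" unfolding y_def using g by simp
    have "?P #> y = C [^]\<^bsub>?Q\<^esub> t" unfolding y_def using P.FactGroup_pow g by simp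
    also have "\<dots> = C [^]\<^bsub>?Q\<^esub> (1 :: nat)" by (rule Q.nat_pow_cong[OF CQ t(1)])
    also have "\<dots> = C" using CQ by (rule Q.nat_pow_eone)
    finally have Cy: "?P #> y = C" .
    have "?P #> (g [^] ?d) = ?P" using Q.pow_ord_eq_1[OF CQ] P.FactGroup_pow g by simp
    then have "g [^] ?d \<in> ?P" using g rcos_self[OF _ P, of "g [^] ?d"] by simp
    then have "ord (g [^] ?d) dvd ord w" by (rule ord_dvd_of_mem_generate[OF fin w])
    moreover have "ord w dvd t" using t(2) by (simp add: cong_0_iff)
    ultimately have "(g [^] ?d) [^] t = \<one>" using g pow_eq_id[of "g [^] ?d" t] dvd_trans by simp
    then have yd: "y [^] ?d = \<one>" unfolding y_def using g by (simp add: nat_pow_pow mult.commute)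
    have ord_u: "ord u > 0" "coprime ?d (ord u)" if "u \<in> ?P" for u
    proof -
      show "ord u > 0" using ord_ge_1[OF fin P.mem_carrier[OF that]] by simp
      have "ord u dvd ord w" using that by (rule ord_dvd_of_mem_generate[OF fin w])
      then show "coprime ?d (ord u)" using coprime_divisors[OF dvd_refl _ cop] by simp
    qed
    have "?d > 0" using Q.ord_ge_1[OF _ CQ] finQ by (simp add: FactGroup_def)
    have inj: "inj_on (\<lambda>u. u \<otimes> y) ?P"
    proof (rule inj_onI)
      fix u v assume "u \<in> ?P" "v \<in> ?P" "u \<otimes> y = v \<otimes> y"
      then show "u = v" using right_cancel[OF y P.mem_carrier P.mem_carrier, of u v] by simp
    qed
    have C_eq: "C = (\<lambda>u. u \<otimes> y) ` ?P"
      using Cy unfolding r_coset_def by blast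
    have "(\<Sum>g\<in>C. totient (ord g)) = (\<Sum>u\<in>?P. totient (ord (u \<otimes> y)))"
      unfolding C_eq sum.reindex[OF inj] o_def ..
    also have "\<dots> \<le> (\<Sum>u\<in>?P. totient ?d * totient (ord u))"
    proof (rule sum_mono)
      fix u assume u: "u \<in> ?P"
      have "totient (ord (u \<otimes> y)) \<le> totient (?d * ord u)"
        using ord_mult_normal_cyclic_dvd[OF fin w normal u y yd] ord_u[OF u] \<open>?d > 0\<close>
        by (intro totient_dvd_mono) simp_all
      then show "totient (ord (u \<otimes> y)) \<le> totient ?d * totient (ord u)"
        using ord_u[OF u] by (simp add: totient_mult_coprime)
    qed
    also have "\<dots> = totient ?d * totient_sq_sum (ord w)"
      using sum_generate_totient_ord[OF fin w] by (simp flip: sum_distrib_left)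
    finally show ?thesis .
  qed
  have "totient_ord_sum G = (\<Sum>g\<in>\<Union>(rcosets ?P). totient (ord g))"
    unfolding totient_ord_sum_def rcosets_part_G[OF P] ..
  also have "\<dots> = (\<Sum>C\<in>rcosets ?P. \<Sum>g\<in>C. totient (ord g))"
    using rcos_disjoint[OF P] fin cosets_finite[OF _ P.subset fin]
    by (subst sum.Union_disjoint) (auto simp: pairwise_def disjnt_def)
  also have "\<dots> \<le> (\<Sum>C\<in>rcosets ?P. totient (Q.ord C) * totient_sq_sum (ord w))"
    by (intro sum_mono coset)
  finally show ?thesis
    by (simp add: totient_ord_sum_def FactGroup_def sum_distrib_left mult.commute)
qed

section \<open>The cyclic case, transport along injections, and the induction\<close>

lemma totient_ord_sum_cyclic:
  assumes "finite (carrier G)" "cyclic_group G"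
  shows "totient_ord_sum G = totient_sq_sum (order G)"
proof -
  obtain x where x: "x \<in> carrier G" "subgroup_generated G {x} = G"
    using assms(2) by (auto simp: cyclic_group_def)
  then have "carrier G = generate G {x}" using carrier_subgroup_generated[of G "{x}"] by simp
  then show ?thesis
    using sum_generate_totient_ord[OF assms(1) x(1)] generate_pow_card[OF x(1)]
    by (simp add: totient_ord_sum_def order_def)
qed

lemma totient_ord_sum_image_group:
  assumes "inj_on f (carrier G)"
  shows "totient_ord_sum (image_group f G) = totient_ord_sum G"
proof -
  interpret H: group "image_group f G" by (rule inj_imp_image_group_is_group[OF assms])
  interpret f: group_hom G "image_group f G" f
    using inj_imp_image_group_iso[OF assms] by unfold_locales (simp add: iso_def)
  have "H.ord (f x) = ord x" if x: "x \<in> carrier G" for x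
  proof -
    have "f x [^]\<^bsub>image_group f G\<^esub> n = \<one>\<^bsub>image_group f G\<^esub> \<longleftrightarrow> x [^] n = \<one>" for n :: nat
      using x assms f.hom_nat_pow[OF x] f.hom_one by (metis inj_on_def nat_pow_closed one_closed)
    then show ?thesis using H.ord_unique[of "f x"] x pow_eq_id by simp
  qed
  then show ?thesis
    unfolding totient_ord_sum_def image_group_carrier by (simp add: sum.reindex[OF assms])
qed

end

text \<open>The induction passes to quotients, whose carrier type differs; fixing the type \<open>nat\<close> and
  transporting the quotient along an injection keeps the statement monomorphic.\<close>
lemma totient_ord_sum_le:
  fixes G :: "nat monoid"
  assumes "group G" "finite (carrier G)"
  shows "totient_ord_sum G \<le> totient_sq_sum (order G)"
  using assms
proof (induction "order G" arbitrary: G rule: less_induct)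
  case less
  interpret group G by (rule less.prems(1))
  note fin = less.prems(2)
  define n where "n = order G"
  have n: "n > 0" unfolding n_def using fin order_gt_0_iff_finite by blast
  show ?case
  proof (cases "\<forall>x\<in>carrier G. n * totient (ord x) \<le> totient_sq_sum n")
    case True
    then have "n * totient_ord_sum G \<le> (\<Sum>x\<in>carrier G. totient_sq_sum n)"
      unfolding totient_ord_sum_def sum_distrib_left by (intro sum_mono) auto
    then show ?thesis using n by (simp add: n_def order_def)
  next
    case False
    then obtain x where x: "x \<in> carrier G" "totient_sq_sum n < n * totient (ord x)" by auto
    have "n \<noteq> 1"
    proof
      assume "n = 1"
      then have "ord x dvd 1" using ord_dvd_group_order[OF x(1)] n_def by simp
      then show False using x(2) \<open>n = 1\<close> by simp
    qed
    define p where "p = Max (prime_factors n)"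
    obtain q where "prime q" "q dvd n" using \<open>n \<noteq> 1\<close> prime_factor_nat[of n] by blast
    then have ne: "prime_factors n \<noteq> {}" using n by (metis empty_iff in_prime_factors_iff not_gr0)
    then have "p \<in> prime_factors n" unfolding p_def by (intro Max_in) auto
    then have p: "prime p" "p dvd n" by auto
    have "q \<le> p" if "prime q" "q dvd n" for q
      unfolding p_def using that n by (intro Max_ge) (auto simp: in_prime_factors_iff)
    then have index: "n div ord x < p"
      using index_less_largest_prime[OF n _ p] x ord_dvd_group_order[OF x(1)] n_def by blast
    have nx: "n = ord x * (n div ord x)" using ord_dvd_group_order[OF x(1)] n_def by simp
    define k where "k = multiplicity p n"
    \<comment> \<open>The index is positive and smaller than \<open>p\<close>, hence coprime to
      \<open>p\<close>, so the full \<open>p\<close>-part of \<open>n\<close> divides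
      \<open>ord x\<close>.\<close>
    have "n div ord x > 0" using nx n by (metis mult_0_right not_gr0)
    then have "\<not> p dvd n div ord x" using index by (auto dest: dvd_imp_le)
    then have "coprime (p ^ k) (n div ord x)" using p(1) by (simp add: prime_imp_coprime)
    moreover have "p ^ k dvd ord x * (n div ord x)" unfolding k_def nx[symmetric] by (rule multiplicity_dvd)
    ultimately have pk: "p ^ k dvd ord x" by (simp add: coprime_dvd_mult_left_iff)
    define u where "u = x [^]\<^bsub>G\<^esub> (ord x div p ^ k)"
    have u: "u \<in> carrier G" "generate G {u} \<lhd> G" "ord u = p ^ k"
      using normal_generate_of_small_index[OF fin x(1) p(1) _ pk] index x(1) unfolding u_def n_def by simp_all
    have pk_n: "p ^ k dvd n" unfolding k_def by (rule multiplicity_dvd)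
    have "\<not> p dvd n div p ^ k"
      unfolding k_def using multiplicity_decompose[of n p] n p(1) not_prime_unit by blast
    then have cop: "coprime (p ^ k) (n div p ^ k)"
      using p(1) by (simp add: prime_imp_coprime)
    let ?Q = "G Mod generate G {u}"
    interpret P: normal "generate G {u}" G by (rule u(2))
    interpret Q: group ?Q by (rule P.factorgroup_is_group)
    have "card (rcosets\<^bsub>G\<^esub> (generate G {u})) * p ^ k = n"
      using lagrange[OF P.is_subgroup] generate_pow_card[OF u(1)] u(3) n_def by simp
    then have orderQ: "order ?Q = n div p ^ k"
      using p(1) by (auto simp: order_def FactGroup_def)
    have finQ: "finite (carrier ?Q)" using fin by (simp add: carrier_FactGroup)
    obtain f :: "nat set \<Rightarrow> nat" where f: "inj_on f (carrier ?Q)"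
      using finite_imp_inj_to_nat_seg[OF finQ] by blast
    let ?R = "image_group f ?Q"
    have R: "order ?R = n div p ^ k" using f orderQ by (simp add: order_def image_group_carrier card_image)
    \<comment> \<open>Ensures that the quotient has strictly smaller order.\<close>
    have "k > 0" unfolding k_def using p n by (simp add: prime_multiplicity_gt_zero_iff)
    then have "p ^ k > 1" using one_less_power[OF prime_gt_1_nat[OF p(1)]] by blast
    then have "order ?R < order G" using R n n_def by simp
    then have "totient_ord_sum ?R \<le> totient_sq_sum (n div p ^ k)"
      using less.hyps[of ?R] Q.inj_imp_image_group_is_group[OF f] finQ R by (simp add: image_group_carrier)
    then have le: "totient_ord_sum ?Q \<le> totient_sq_sum (n div p ^ k)"
      using Q.totient_ord_sum_image_group[OF f] by simp
    have "totient_ord_sum G \<le> totient_sq_sum (p ^ k) * totient_ord_sum ?Q"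
      using totient_ord_sum_le_normal_cyclic[OF fin u(1,2)] u(3) cop n_def by simp
    also have "\<dots> \<le> totient_sq_sum (p ^ k) * totient_sq_sum (n div p ^ k)"
      using le by (rule mult_left_mono) simp
    also have "\<dots> = totient_sq_sum (p ^ k * (n div p ^ k))"
      using cop pk_n n p(1) by (intro totient_sq_sum_mult_coprime[symmetric]) (auto simp: prime_gt_0_nat intro!: Nat.gr0I)
    also have "p ^ k * (n div p ^ k) = order G" using pk_n n_def by simp
    finally show ?thesis .
  qed
qed

section \<open>From totient sums to undirected edges\<close>

text \<open>The right-hand side counts ordered pairs of elements generating the same subgroup. The
  diagonal accounts for \<open>order G\<close>, and every edge for two pairs.\<close>

lemma (in group) card_undirected_edges:
  assumes fin: "finite (carrier G)"
  shows "2 * card (undirected_edges (directed_power_graph G)) + order G = totient_ord_sum G"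
proof -
  let ?D = "directed_power_graph G" and ?f = "\<lambda>(g, h). {g, h}"
  let ?B = "\<lambda>g. {h \<in> generate G {g}. ord h = ord g}"
  define A where "A = {(g, h). (g, h) \<in> parcs ?D \<and> (h, g) \<in> parcs ?D}"
  have E: "undirected_edges ?D = ?f ` A"
    unfolding undirected_edges_def A_def by auto
  have sub: "generate G {g} \<subseteq> carrier G" if "g \<in> carrier G" for g
    using generate_incl[of "{g}"] that by simp
  have "(g, h) \<in> A \<longleftrightarrow> g \<in> carrier G \<and> h \<in> ?B g - {g}" for g h
    using mutual_generate_iff[OF fin, of g h] sub[of g]
    unfolding A_def directed_power_graph_def by auto
  then have A: "A = Sigma (carrier G) (\<lambda>g. ?B g - {g})" by auto
  have finB: "finite (?B g)" if "g \<in> carrier G" for g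
    using sub[OF that] fin by (auto intro: finite_subset)
  have finA: "finite A" unfolding A using fin finB by auto
  have "card (?B g - {g}) + 1 = totient (ord g)" if "g \<in> carrier G" for g
  proof -
    have "g \<in> ?B g" by (simp add: generate.incl)
    then show ?thesis using card_Suc_Diff1[OF finB[OF that]] card_generators[OF fin that] by simp
  qed
  then have "totient_ord_sum G = (\<Sum>g\<in>carrier G. card (?B g - {g}) + 1)"
    unfolding totient_ord_sum_def by simp
  also have "\<dots> = card A + order G"
    unfolding A sum.distrib using fin finB by (subst card_SigmaI) (auto simp: order_def)
  finally have "totient_ord_sum G = card A + order G" .
  \<comment> \<open>The pairs are grouped by the edge they form; each fibre has two members because
    arcs are never loops.\<close>
  moreover have "(\<Sum>e\<in>?f ` A. \<Sum>a\<in>{a \<in> A. ?f a = e}. 1) = (\<Sum>a\<in>A. 1 :: nat)"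
    using finA by (intro sum.group) auto
  moreover have "card {a \<in> A. ?f a = e} = 2" if "e \<in> ?f ` A" for e
  proof -
    from that obtain g h where gh: "(g, h) \<in> A" "e = {g, h}" by auto
    then have "(h, g) \<in> A" "g \<noteq> h" unfolding A_def directed_power_graph_def by auto
    then have "{a \<in> A. ?f a = e} = {(g, h), (h, g)}" using gh by (auto simp: doubleton_eq_iff)
    then show ?thesis using \<open>g \<noteq> h\<close> by simp
  qed
  ultimately show ?thesis unfolding E by simp
qed

theorem theorem1p6:
  fixes n :: nat
    and G :: "('a, 'm) monoid_scheme"
    and C :: "('c, 'k) monoid_scheme"
  assumes "n > 0"
    and "group G" and "order G = n"
    and "group C" and "cyclic_group C" and "order C = n"
  shows "card (undirected_edges (directed_power_graph G))
       \<le> card (undirected_edges (directed_power_graph C))"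
proof -
  interpret G: group G by (rule assms(2))
  interpret C: group C by (rule assms(4))
  have fin: "finite (carrier G)" "finite (carrier C)"
    using assms(1,3,6) G.order_gt_0_iff_finite C.order_gt_0_iff_finite by auto
  \<comment> \<open>\<open>G\<close> is copied to the type \<open>nat\<close>, where the inequality
    was proved; for \<open>C\<close> the exact value is available at any type.\<close>
  obtain f :: "'a \<Rightarrow> nat" where f: "inj_on f (carrier G)"
    using finite_imp_inj_to_nat_seg[OF fin(1)] by blast
  have "totient_ord_sum (image_group f G) \<le> totient_sq_sum (order (image_group f G))"
    using G.inj_imp_image_group_is_group[OF f] fin(1)
    by (intro totient_ord_sum_le) (simp_all add: image_group_carrier)
  also have "order (image_group f G) = n"
    using f assms(3) by (simp add: order_def image_group_carrier card_image)
  finally have "totient_ord_sum G \<le> totient_ord_sum C"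
    using G.totient_ord_sum_image_group[OF f] C.totient_ord_sum_cyclic[OF fin(2) assms(5)] assms(6) by simp
  then show ?thesis
    using G.card_undirected_edges[OF fin(1)] C.card_undirected_edges[OF fin(2)] assms(3,6) by simp
qed

end
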